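(* Let $(\mathcal F,\mathcal V,\mathbf 1,\boldsymbol\omega)$ be a vertex algebra with grading $\mathcal F=\bigoplus_{n\in\mathbb Z}\mathcal F_{(n)}$, and let $C:=\operatorname{span}\{\psi_{-2}\varphi \mid \psi,\varphi\in\mathcal F\}$. The dot product $\psi\cdot\varphi:=\psi_{-1}\varphi$ and the bracket $[\psi,\varphi]:=\psi_0\varphi$ induce bilinear operations on the quotient space $\mathcal F/C$ which enjoy the following properties for all $\psi,\varphi,\xi\in\mathcal F/C$: (i) $\psi\cdot\varphi=\varphi\cdot\psi$; (ii) $(\psi\cdot\varphi)\cdot\xi=\psi\cdot(\varphi\cdot\xi)$; (iii) $[\psi,\varphi]=-[\varphi,\psi]$; (iv) $[[\psi,\varphi],\xi]+[[\varphi,\xi],\psi]+[[\xi,\psi],\varphi]=0$; (v) $[\psi,\varphi\cdot\xi]=[\psi,\varphi]\cdot\xi+\varphi\cdot[\psi,\xi]$; (vi) for all $m,n\in\mathbb Z$, the bracket restricts to a map $[\cdot,\cdot]:\ \mathcal F_{(m)}/(C\cap\mathcal F_{(m)})\times\mathcal F_{(n)}/(C\cap\mathcal F_{(n)})\longrightarrow\mathcal F_{(m+n-1)}/(C\cap\mathcal F_{(m+n-1)})$.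
   Context: A vertex algebra $(\mathcal F,\mathcal V,\mathbf 1,\boldsymbol\omega)$ is a $\mathbb Z$-graded complex vector space $\mathcal F=\bigoplus_{n\in\mathbb Z}\mathcal F_{(n)}$ with a linear map $\mathcal V:\mathcal F\to(\operatorname{End}\mathcal F)[[z,z^{-1}]]$, $\psi\mapsto\mathcal V(\psi,z)=\sum_{n\in\mathbb Z}\psi_n z^{-n-1}$ (this defines the modes $\psi_n\in\operatorname{End}\mathcal F$), and distinguished vectors $\mathbf 1,\boldsymbol\omega\in\mathcal F$, such that: (1) (Regularity) for $\psi,\varphi\in\mathcal F$, $\psi_n\varphi=0$ for all sufficiently large $n$ (depending on $\psi,\varphi$). (2) (Vacuum) $\mathcal V(\mathbf 1,z)=\mathrm{id}_{\mathcal F}$. (3) (Injectivity) $\mathcal V(\psi,z)=0$ if and only if $\psi=0$. (4) (Conformal vector) Writing $\mathcal V(\boldsymbol\omega,z)=\sum_{n\in\mathbb Z}L_{(n)}z^{-n-2}$ (i.e. $L_{(n)}=\boldsymbol\omega_{n+1}$), one has $[L_{(m)},L_{(n)}]=(m-n)L_{(m+n)}+\frac{c}{12}(m^3-m)\delta_{m+n,0}$ for some $c\in\mathbb C$; $\mathcal V(L_{(-1)}\psi,z)=\frac{d}{dz}\mathcal V(\psi,z)$ for all $\psi\in\mathcal F$; and $L_{(0)}\psi=n\psi$ for all $\psi\in\mathcal F_{(n)}$, $n\in\mathbb Z$. (5) (Jacobi identity) For all $\psi,\varphi,\xi\in\mathcal F$ and $l,m,n\in\mathbb Z$, $$\sum_{i\ge0}(-1)^i\binom{l}{i}\Big(\psi_{l+m-i}(\varphi_{n+i}\xi)-(-1)^l\varphi_{l+n-i}(\psi_{m+i}\xi)\Big)=\sum_{i\ge0}\binom{m}{i}(\psi_{l+i}\varphi)_{m+n-i}\,\xi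 .$$ No finite-dimensionality of the $\mathcal F_{(n)}$ and no lower bound on the grading is assumed. *)

theory Defs
  imports Complex_Main "HOL-Library.Groups_Big_Fun" "HOL-Library.Set_Algebras"
begin

section \<open>Vertex algebras\<close>

text \<open>
  A formal series in \<open>(End F)[[z, z\<^sup>-\<^sup>1]]\<close> is the function of type \<open>int \<Rightarrow> 'a \<Rightarrow> 'a\<close> sending \<open>k\<close> to the
  coefficient of \<open>z\<^sup>k\<close>. Since \<open>V(\<psi>,z)\<close> is expanded as the sum of the \<open>\<psi>\<^sub>n z\<^sup>-\<^sup>n\<^sup>-\<^sup>1\<close>, the mode \<open>\<psi>\<^sub>n\<close> is the
  coefficient of index \<open>-n-1\<close>.
\<close>

definition mode :: "('a \<Rightarrow> int \<Rightarrow> 'a \<Rightarrow> 'a) \<Rightarrow> 'a \<Rightarrow> int \<Rightarrow> 'a \<Rightarrow> 'a"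
  where "mode V \<psi> n = V \<psi> (- n - 1)"

text \<open>
  The sums over \<open>i \<ge> 0\<close> in the Jacobi identity are rendered by \<^const>\<open>Sum_any\<close>, the sum over the support;
  by regularity all these supports are finite. The same operator expresses the homogeneous
  decomposition of a vector, where finiteness of the support is required explicitly.
\<close>

locale vertex_algebra = vector_space scale
  for scale :: "complex \<Rightarrow> 'a::ab_group_add \<Rightarrow> 'a" (infixr "*\<^sub>V" 75) +
  fixes F :: "int \<Rightarrow> 'a set"
    and V :: "'a \<Rightarrow> int \<Rightarrow> 'a \<Rightarrow> 'a"
    and vac :: 'a
    and \<omega> :: 'a
  assumes grading_subspace: "module.subspace scale (F n)"
    and grading_direct_sum:
      "\<exists>!x. (\<forall>n. x n \<in> F n) \<and> finite {n. x n \<noteq> 0} \<and> \<psi> = Sum_any x"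
    and coeff_linear: "Vector_Spaces.linear scale scale (V \<psi> k)"
    and V_linear: "Vector_Spaces.linear scale scale (\<lambda>\<psi>. V \<psi> k \<phi>)"
    and regularity: "\<exists>N. \<forall>n\<ge>N. mode V \<psi> n \<phi> = 0"
    and vacuum: "V vac k \<phi> = (if k = 0 then \<phi> else 0)"
    and injectivity: "(\<forall>k \<phi>. V \<psi> k \<phi> = 0) \<longleftrightarrow> \<psi> = 0"
    and virasoro:
      "\<exists>c. \<forall>m n \<phi>.
         mode V \<omega> (m + 1) (mode V \<omega> (n + 1) \<phi>) - mode V \<omega> (n + 1) (mode V \<omega> (m + 1) \<phi>) =
         of_int (m - n) *\<^sub>V mode V \<omega> (m + n + 1) \<phi> +
         (if m + n = 0 then (c / 12 * of_int (m ^ 3 - m)) *\<^sub>V \<phi> else 0)"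
    and translation:
      "V (mode V \<omega> 0 \<psi>) k \<phi> = of_int (k + 1) *\<^sub>V V \<psi> (k + 1) \<phi>"
    and weight: "\<psi> \<in> F n \<Longrightarrow> mode V \<omega> 1 \<psi> = of_int n *\<^sub>V \<psi>"
    and jacobi:
      "Sum_any (\<lambda>i::nat. ((-1) ^ i * (of_int l gchoose i)) *\<^sub>V
          (mode V \<psi> (l + m - int i) (mode V \<phi> (n + int i) \<xi>) -
           ((-1) powi l) *\<^sub>V mode V \<phi> (l + n - int i) (mode V \<psi> (m + int i) \<xi>))) =
       Sum_any (\<lambda>i::nat. (of_int m gchoose i) *\<^sub>V
          mode V (mode V \<psi> (l + int i) \<phi>) (m + n - int i) \<xi>)"

section \<open>Quotient spaces\<close>

text \<open>
  For subspaces \<open>W \<subseteq> U\<close>, the elements of \<open>U/W\<close> are the cosets \<open>u +o W\<close>. Addition in \<open>U/W\<close> is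
  elementwise addition of sets and \<open>W\<close> is the zero vector. In a scalar multiple, adding \<open>W\<close> again
  matters only for the scalar 0. The negative of a coset \<open>A\<close> is \<open>uminus ` A\<close>, because \<open>- A\<close> denotes
  the set complement.
\<close>

definition quot_space :: "'a::ab_group_add set \<Rightarrow> 'a set \<Rightarrow> 'a set set"
  where "quot_space U W = (\<lambda>u. u +o W) ` U"

definition quot_scale ::
    "(complex \<Rightarrow> 'a::ab_group_add \<Rightarrow> 'a) \<Rightarrow> 'a set \<Rightarrow> complex \<Rightarrow> 'a set \<Rightarrow> 'a set"
  where "quot_scale scale W c A = scale c ` A + W"

text \<open>
  The operation on cosets of \<open>W\<close> induced by \<open>f\<close>. It is well defined exactly if all representatives
  give the same coset, that is, if \<open>quot_op W f (a +o W) (b +o W) = f a b +o W\<close>.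
\<close>

definition quot_op ::
    "'a::ab_group_add set \<Rightarrow> ('a \<Rightarrow> 'a \<Rightarrow> 'a) \<Rightarrow> 'a set \<Rightarrow> 'a set \<Rightarrow> 'a set"
  where "quot_op W f A B = (\<Union>a\<in>A. \<Union>b\<in>B. f a b +o W)"

definition quot_bilinear ::
    "(complex \<Rightarrow> 'a::ab_group_add \<Rightarrow> 'a) \<Rightarrow> 'a set \<Rightarrow> ('a set \<Rightarrow> 'a set \<Rightarrow> 'a set) \<Rightarrow> bool"
  where "quot_bilinear scale W g \<longleftrightarrow>
    (\<forall>A\<in>quot_space UNIV W. \<forall>B\<in>quot_space UNIV W.
       g A B \<in> quot_space UNIV W \<and>
       (\<forall>A'\<in>quot_space UNIV W. g (A + A') B = g A B + g A' B) \<and>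
       (\<forall>B'\<in>quot_space UNIV W. g A (B + B') = g A B + g A B') \<and>
       (\<forall>c. g (quot_scale scale W c A) B = quot_scale scale W c (g A B)) \<and>
       (\<forall>c. g A (quot_scale scale W c B) = quot_scale scale W c (g A B)))"

text \<open>
  The canonical map from \<open>U/(W \<inter> U)\<close> to the quotient of the whole space by \<open>W\<close>. It is injective by
  the lemmas below, and \<open>U/(W \<inter> U)\<close> is identified with its image.
\<close>

definition quot_incl :: "'a::ab_group_add set \<Rightarrow> 'a set \<Rightarrow> 'a set"
  where "quot_incl W A = A + W"

lemma quot_incl_coset:
  assumes "module scale" "module.subspace scale U" "module.subspace scale W"
  shows "quot_incl W (u +o (W \<inter> U)) = u +o W"
proof -
  interpret module scale by fact
  have "(W \<inter> U) + W = W"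
  proof
    show "(W \<inter> U) + W \<subseteq> W"
      using subspace_add[OF assms(3)] by (auto elim!: set_plus_elim)
    show "W \<subseteq> (W \<inter> U) + W"
      using subspace_0[OF assms(2)] subspace_0[OF assms(3)] set_plus_intro[of 0 "W \<inter> U" _ W] by auto
  qed
  then show ?thesis
    unfolding quot_incl_def by (metis set_plus_rearrange3)
qed

lemma inj_on_quot_incl:
  assumes "module scale" "module.subspace scale U" "module.subspace scale W"
  shows "inj_on (quot_incl W) (quot_space U (W \<inter> U))"
proof (rule inj_onI)
  interpret module scale by fact
  fix A B
  assume "A \<in> quot_space U (W \<inter> U)" "B \<in> quot_space U (W \<inter> U)"
    and eq: "quot_incl W A = quot_incl W B"
  then obtain a b where ab: "a \<in> U" "b \<in> U" "A = a +o (W \<inter> U)" "B = b +o (W \<inter> U)"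
    by (auto simp: quot_space_def)
  have "a +o W = b +o W"
    using eq ab quot_incl_coset[OF assms] by simp
  moreover have "a \<in> a +o W"
    using subspace_0[OF assms(3)] by (force simp: elt_set_plus_def)
  ultimately have "a - b \<in> W"
    by (auto simp: elt_set_plus_def)
  then have d: "a - b \<in> W \<inter> U"
    using ab subspace_diff[OF assms(2)] by blast
  have sub: "subspace (W \<inter> U)"
    using assms(2,3) by (simp add: subspace_inter)
  have "x \<in> A \<longleftrightarrow> x \<in> B" for x
  proof -
    have "x \<in> A \<longleftrightarrow> x - a \<in> W \<inter> U" "x \<in> B \<longleftrightarrow> x - b \<in> W \<inter> U"
      unfolding ab by (simp_all only: set_minus_plus)
    moreover have "x - b = (x - a) + (a - b)" "x - a = (x - b) - (a - b)"
      by simp_all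
    ultimately show ?thesis
      using d sub by (metis subspace_add subspace_diff)
  qed
  then show "A = B" by blast
qed

end

theory Submission
  imports Defs
begin

text \<open>
  Every mode \<open>\<psi>\<^sub>n\<close> with \<open>n \<le> -2\<close> maps into \<open>C\<close>, because translation covariance expresses \<open>\<psi>\<^sub>n\<close>
  through \<open>(L\<^sub>-\<^sub>1\<psi>)\<^sub>n\<^sub>+\<^sub>1\<close>. Modulo \<open>C\<close>, the terms of the Jacobi identity with such outer modes drop out.
  Its instance \<open>m = n = -1\<close>, \<open>\<xi> = \<one>\<close>, with \<open>\<psi>\<^sub>k\<one> = 0\<close> for \<open>k \<ge> 0\<close> and \<open>\<psi>\<^sub>-\<^sub>1\<one> = \<psi>\<close>, gives
  \<open>\<psi>\<^sub>k\<phi> \<equiv> -(-1)\<^sup>k \<phi>\<^sub>k\<psi>\<close> modulo \<open>C\<close>, where \<open>k = l - 1\<close>; this covers (i) and (iii). The cases \<open>l = 0\<close> and \<open>l = -1, m = 0\<close> are the commutator and the iterate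
  formulas, which give (iv), (v) and (ii). For (vi), \<open>\<psi>\<^sub>0\<phi>\<close> is an eigenvector of \<open>L\<^sub>0\<close> by the
  commutator formula, and by directness of the grading the eigenvectors of \<open>L\<^sub>0\<close> are homogeneous.
\<close>

section \<open>Cosets of a subspace\<close>

lemmas in_coset_iff = set_minus_plus[symmetric]

context vector_space
begin

lemma subspace_Sum_any:
  assumes "subspace W" "\<And>i. g i \<in> W"
  shows "Sum_any g \<in> W"
  unfolding Sum_any.expand_set by (rule subspace_sum) (use assms in auto)

lemma coset_eq_iff:
  assumes "subspace W"
  shows "a +o W = b +o W \<longleftrightarrow> a - b \<in> W"
proof
  assume "a +o W = b +o W"
  moreover have "a \<in> a +o W"
    using subspace_0[OF assms] by (simp add: in_coset_iff)
  ultimately show "a - b \<in> W"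
    by (simp add: in_coset_iff)
next
  assume "a - b \<in> W"
  moreover have "x - b = (x - a) + (a - b)" "x - a = (x - b) - (a - b)" for x
    by simp_all
  ultimately have "x - a \<in> W \<longleftrightarrow> x - b \<in> W" for x
    by (metis assms subspace_add subspace_diff)
  then show "a +o W = b +o W"
    by (auto simp: in_coset_iff)
qed

lemma subspace_plus_self:
  assumes "subspace W"
  shows "W + W = W"
proof
  show "W + W \<subseteq> W"
    using subspace_add[OF assms] by (auto elim!: set_plus_elim)
  show "W \<subseteq> W + W"
    using set_plus_intro[OF subspace_0[OF assms], of _ W] by auto
qed

lemma coset_add:
  assumes "subspace W"
  shows "(a +o W) + (b +o W) = (a + b) +o W"
  by (simp add: set_plus_rearrange subspace_plus_self[OF assms])

lemma coset_uminus:
  assumes "subspace W"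
  shows "uminus ` (a +o W) = (- a) +o W"
proof -
  have "x \<in> uminus ` (a +o W) \<longleftrightarrow> - x \<in> a +o W" for x
    by (metis image_iff minus_minus)
  also have "- x \<in> a +o W \<longleftrightarrow> - (x - (- a)) \<in> W" for x
    by (simp add: in_coset_iff)
  also have "- (x - (- a)) \<in> W \<longleftrightarrow> x \<in> (- a) +o W" for x
    by (metis assms in_coset_iff minus_minus subspace_neg)
  finally show ?thesis by blast
qed

end

section \<open>Operations induced on cosets\<close>

lemma quot_scale_coset:
  assumes "vector_space scale" "module.subspace scale W"
  shows "quot_scale scale W c (a +o W) = scale c a +o W"
proof -
  interpret vector_space scale by fact
  have img: "scale c ` (a +o W) = scale c a +o scale c ` W"
    by (force simp: elt_set_plus_def scale_right_distrib)
  have "scale c ` W + W = W"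
  proof
    show "scale c ` W + W \<subseteq> W"
      using subspace_add[OF assms(2)] subspace_scale[OF assms(2)] by (auto elim!: set_plus_elim)
    show "W \<subseteq> scale c ` W + W"
      using subspace_0[OF assms(2)] by (intro set_zero_plus2) (force simp: image_iff)+
  qed
  then show ?thesis
    unfolding quot_scale_def img by (simp add: set_plus_rearrange3)
qed

text \<open>Bilinearity splits \<open>f a' b' - f a b\<close> into
  \<open>f (a' - a) b' + f a (b' - b)\<close>, and each summand has an argument in \<open>W\<close>.
  Hence all cosets in the union defining \<open>quot_op\<close> coincide.\<close>

lemma quot_op_coset:
  assumes "vector_space scale" "module.subspace scale W"
    and lin1: "\<And>b. Vector_Spaces.linear scale scale (\<lambda>a. f a b)"
    and lin2: "\<And>a. Vector_Spaces.linear scale scale (f a)"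
    and W1: "\<And>a b. a \<in> W \<Longrightarrow> f a b \<in> W"
    and W2: "\<And>a b. b \<in> W \<Longrightarrow> f a b \<in> W"
  shows "quot_op W f (a +o W) (b +o W) = f a b +o W"
proof -
  interpret vector_space scale by fact
  have eq: "f a' b' +o W = f a b +o W" if "a' \<in> a +o W" "b' \<in> b +o W" for a' b'
  proof -
    have "f (a' - a) b' + f a (b' - b) \<in> W"
      using that by (intro subspace_add[OF assms(2)] W1 W2) (auto simp: in_coset_iff)
    moreover have "f (a' - a) b' = f a' b' - f a b'"
      using module_hom.diff[OF Vector_Spaces.linear.axioms(3)[OF lin1]] .
    moreover have "f a (b' - b) = f a b' - f a b"
      using module_hom.diff[OF Vector_Spaces.linear.axioms(3)[OF lin2]] .
    ultimately have "f a' b' - f a b \<in> W"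
      by simp
    then show ?thesis
      by (simp add: coset_eq_iff[OF assms(2)])
  qed
  have "a \<in> a +o W" "b \<in> b +o W"
    using subspace_0[OF assms(2)] by (simp_all add: in_coset_iff)
  with eq show ?thesis
    unfolding quot_op_def by blast
qed

lemma quot_bilinear_quot_op:
  assumes "vector_space scale" "module.subspace scale W"
    and lin1: "\<And>b. Vector_Spaces.linear scale scale (\<lambda>a. f a b)"
    and lin2: "\<And>a. Vector_Spaces.linear scale scale (f a)"
    and W1: "\<And>a b. a \<in> W \<Longrightarrow> f a b \<in> W"
    and W2: "\<And>a b. b \<in> W \<Longrightarrow> f a b \<in> W"
  shows "quot_bilinear scale W (quot_op W f)"
proof -
  interpret vector_space scale by fact
  note op = quot_op_coset[OF assms]
  show ?thesis
    unfolding quot_bilinear_def quot_space_def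
    using module_hom.add[OF Vector_Spaces.linear.axioms(3)[OF lin1]] module_hom.add[OF Vector_Spaces.linear.axioms(3)[OF lin2]] module_hom.scale[OF Vector_Spaces.linear.axioms(3)[OF lin1]] module_hom.scale[OF Vector_Spaces.linear.axioms(3)[OF lin2]]
    by (auto simp: op coset_add[OF assms(2)] quot_scale_coset[OF assms(1,2)])
qed

section \<open>Modes of a vertex algebra\<close>

lemma Sum_any_single:
  assumes "\<And>j. j \<noteq> i \<Longrightarrow> g j = 0"
  shows "Sum_any g = g i"
proof -
  have "Sum_any g = sum g {i}"
    by (rule Sum_any.expand_superset) (use assms in auto)
  then show ?thesis by simp
qed

lemma gbinomial_minus_one: "(- 1 :: 'a::field_char_0) gchoose i = (- 1) ^ i"
  using gbinomial_minus[of "1 :: 'a" i] by (simp add: binomial_gbinomial[symmetric])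

context vertex_algebra
begin

section \<open>Linearity, vacuum and translation in terms of modes\<close>

lemma linear_mode_right: "Vector_Spaces.linear scale scale (mode V \<psi> n)"
  unfolding mode_def by (rule coeff_linear)

lemma linear_mode_left: "Vector_Spaces.linear scale scale (\<lambda>\<psi>. mode V \<psi> n \<phi>)"
  unfolding mode_def by (rule V_linear)

lemmas mode_right_simps =
  module_hom.zero[OF Vector_Spaces.linear.axioms(3)[OF linear_mode_right]]
  module_hom.add[OF Vector_Spaces.linear.axioms(3)[OF linear_mode_right]]
  module_hom.diff[OF Vector_Spaces.linear.axioms(3)[OF linear_mode_right]]
  module_hom.neg[OF Vector_Spaces.linear.axioms(3)[OF linear_mode_right]]
  module_hom.scale[OF Vector_Spaces.linear.axioms(3)[OF linear_mode_right]]

lemmas mode_left_simps =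
  module_hom.zero[OF Vector_Spaces.linear.axioms(3)[OF linear_mode_left]]
  module_hom.add[OF Vector_Spaces.linear.axioms(3)[OF linear_mode_left]]
  module_hom.diff[OF Vector_Spaces.linear.axioms(3)[OF linear_mode_left]]
  module_hom.neg[OF Vector_Spaces.linear.axioms(3)[OF linear_mode_left]]
  module_hom.scale[OF Vector_Spaces.linear.axioms(3)[OF linear_mode_left]]

lemma mode_vac: "mode V vac n \<phi> = (if n = -1 then \<phi> else 0)"
  unfolding mode_def by (simp add: vacuum)

lemma mode_translate: "mode V (mode V \<omega> 0 \<psi>) n \<phi> = of_int (- n) *\<^sub>V mode V \<psi> (n - 1) \<phi>"
  using translation[of \<psi> "- n - 1" \<phi>] by (simp add: mode_def)

lemma mode_eqI:
  assumes "\<And>n \<xi>. mode V \<psi> n \<xi> = mode V \<phi> n \<xi>"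
  shows "\<psi> = \<phi>"
proof -
  have "V (\<psi> - \<phi>) k \<xi> = 0" for k \<xi>
    using assms[of "- k - 1" \<xi>] by (simp add: module_hom.diff[OF Vector_Spaces.linear.axioms(3)[OF V_linear]] mode_def)
  then show ?thesis
    using injectivity[of "\<psi> - \<phi>"] by simp
qed

text \<open>Jacobi identity at \<open>l = 0\<close>: \<open>0 gchoose i\<close> leaves only the term
  \<open>i = 0\<close> on the left.\<close>

lemma commutator:
  "mode V \<psi> m (mode V \<phi> n \<xi>) - mode V \<phi> n (mode V \<psi> m \<xi>) =
    Sum_any (\<lambda>i::nat. (of_int m gchoose i) *\<^sub>V mode V (mode V \<psi> (int i) \<phi>) (m + n - int i) \<xi>)"
  unfolding jacobi[of 0 \<psi> m \<phi> n \<xi>, simplified, symmetric]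
  by (subst Sum_any_single[of 0]) (auto simp: gbinomial_0_left)

lemma iterate:
  "mode V (mode V \<psi> (-1) \<phi>) n \<xi> =
    Sum_any (\<lambda>i::nat. mode V \<psi> (- 1 - int i) (mode V \<phi> (n + int i) \<xi>) +
      mode V \<phi> (n - 1 - int i) (mode V \<psi> (int i) \<xi>))"
proof -
  \<comment> \<open>With \<open>m = 0\<close> the right side of the Jacobi identity reduces to its
    term \<open>i = 0\<close>.\<close>
  have "mode V (mode V \<psi> (-1) \<phi>) n \<xi> =
    Sum_any (\<lambda>i::nat. (of_int 0 gchoose i) *\<^sub>V mode V (mode V \<psi> (-1 + int i) \<phi>) (0 + n - int i) \<xi>)"
    by (subst Sum_any_single[of 0]) (auto simp: gbinomial_0_left)
  also have "\<dots> = Sum_any (\<lambda>i::nat. ((-1) ^ i * (of_int (-1) gchoose i)) *\<^sub>V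
      (mode V \<psi> (-1 + 0 - int i) (mode V \<phi> (n + int i) \<xi>) -
       ((-1) powi (-1)) *\<^sub>V mode V \<phi> (-1 + n - int i) (mode V \<psi> (0 + int i) \<xi>)))"
    by (rule jacobi[symmetric])
  also have "\<dots> = Sum_any (\<lambda>i::nat. mode V \<psi> (- 1 - int i) (mode V \<phi> (n + int i) \<xi>) +
      mode V \<phi> (n - 1 - int i) (mode V \<psi> (int i) \<xi>))"
    \<comment> \<open>The sign \<open>(-1) ^ i\<close> cancels against \<open>-1 gchoose i\<close>,
      and \<open>(-1) powi (-1) = -1\<close> turns the difference into a sum.\<close>
    by (simp add: gbinomial_minus_one power_mult_distrib[symmetric] algebra_simps)
  finally show ?thesis .
qed

text \<open>Modes of \<open>vac\<close> are the identity or zero, so they commute with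
  \<open>\<psi>\<^sub>k\<close>. In the commutator formula the terms \<open>i < k\<close> vanish by
  induction and the terms \<open>i > k\<close> by the binomial coefficient; the remaining term shows
  that all modes of \<open>\<psi>\<^sub>k vac\<close> are zero, and injectivity applies.\<close>

lemma mode_nonneg_vac: "mode V \<psi> (int k) vac = 0"
proof (induction k rule: less_induct)
  case (less k)
  have "mode V (mode V \<psi> (int k) vac) n \<xi> = 0" for n \<xi>
  proof -
    have "Sum_any (\<lambda>i::nat. (of_int (int k) gchoose i) *\<^sub>V
        mode V (mode V \<psi> (int i) vac) (int k + (n :: int) - int i) \<xi>) = mode V (mode V \<psi> (int k) vac) n \<xi>"
    proof (subst Sum_any_single[of k])
      show "(of_int (int k) gchoose i) *\<^sub>V mode V (mode V \<psi> (int i) vac) (int k + n - int i) \<xi> = 0"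
        if "i \<noteq> k" for i
        using that less by (cases "i < k")
          (auto simp: mode_left_simps binomial_gbinomial[symmetric] binomial_eq_0)
    qed (simp add: binomial_gbinomial[symmetric])
    moreover have "mode V \<psi> (int k) (mode V vac n \<xi>) - mode V vac n (mode V \<psi> (int k) \<xi>) = 0"
      by (simp add: mode_vac mode_right_simps)
    ultimately show ?thesis
      by (simp only: commutator)
  qed
  then show ?case
    using mode_eqI[of "mode V \<psi> (int k) vac" 0] by (simp add: mode_left_simps)
qed

lemma mode_minus_one_vac: "mode V \<psi> (-1) vac = \<psi>"
proof (rule mode_eqI)
  fix n \<xi>
  \<comment> \<open>A mode of \<open>vac\<close> survives only at index -1: in the first summand of
    \<open>iterate\<close> at \<open>i = -1 - n\<close>, possible for \<open>n < 0\<close>, and in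
    the second at \<open>i = n\<close>, possible for \<open>n \<ge> 0\<close>. Either way
    \<open>\<psi>\<^sub>n \<xi>\<close> results.\<close>
  have "mode V (mode V \<psi> (-1) vac) n \<xi> =
    Sum_any (\<lambda>i::nat. if i = nat (if n < 0 then - 1 - n else n) then mode V \<psi> n \<xi> else 0)"
    unfolding iterate
    by (rule Sum_any.cong) (auto simp: mode_vac mode_right_simps)
  then show "mode V (mode V \<psi> (-1) vac) n \<xi> = mode V \<psi> n \<xi>"
    by simp
qed

section \<open>The subspace \<open>C\<close>\<close>

definition c2_space :: "'a set"
  where "c2_space = span {mode V \<psi> (-2) \<phi> | \<psi> \<phi>. True}"

lemma subspace_c2_space: "subspace c2_space"
  unfolding c2_space_def by (rule subspace_span)

lemma linear_preserves_c2_space: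
  assumes "Vector_Spaces.linear scale scale g" and "\<And>\<psi> \<phi>. g (mode V \<psi> (-2) \<phi>) \<in> c2_space"
    and "x \<in> c2_space"
  shows "g x \<in> c2_space"
  using assms(3) unfolding c2_space_def
proof (induction rule: span_induct)
  case base
  show ?case
    using module_hom.subspace_vimage[OF Vector_Spaces.linear.axioms(3)[OF assms(1)] subspace_c2_space]
    by (simp add: c2_space_def vimage_def)
next
  case (step x)
  then show ?case using assms(2) by (auto simp: c2_space_def)
qed

lemma mode_in_c2_space: "n \<le> -2 \<Longrightarrow> mode V \<psi> n \<phi> \<in> c2_space"
proof (induction n arbitrary: \<psi> rule: int_le_induct)
  case base
  show ?case unfolding c2_space_def by (rule span_base) auto
next
  case (step n)
  \<comment> \<open>The induction runs downwards from -2, so the factor \<open>-n\<close> from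
    translation is nonzero and can be inverted.\<close>
  have "mode V \<psi> (n - 1) \<phi> = inverse (of_int (- n)) *\<^sub>V mode V (mode V \<omega> 0 \<psi>) n \<phi>"
    using step.hyps by (simp add: mode_translate)
  then show ?case
    using step.IH subspace_scale[OF subspace_c2_space] by metis
qed

text \<open>Besides commutativity (\<open>n = -1\<close>) and antisymmetry (\<open>n = 0\<close>),
  this carries stability of \<open>c2_space\<close> from the right argument over to the left
  one.\<close>

lemma skew_symmetry:
  "mode V \<psi> n \<phi> - (-1) powi (n + 1) *\<^sub>V mode V \<phi> n \<psi> \<in> c2_space"
proof -
  have "Sum_any (\<lambda>i::nat. ((-1) ^ i * (of_int (n + 1) gchoose i)) *\<^sub>V
          (mode V \<psi> (n + 1 + (-1) - int i) (mode V \<phi> (-1 + int i) vac) -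
           ((-1) powi (n + 1)) *\<^sub>V mode V \<phi> (n + 1 + (-1) - int i) (mode V \<psi> (-1 + int i) vac)))
     = mode V \<psi> n \<phi> - (-1) powi (n + 1) *\<^sub>V mode V \<phi> n \<psi>"
  proof (subst Sum_any_single[of 0])
    fix i :: nat
    assume "i \<noteq> 0"
    \<comment> \<open>For \<open>i > 0\<close> the inner modes have nonnegative index and kill
      \<open>vac\<close>.\<close>
    then have "-1 + int i = int (i - 1)" by simp
    then show "((-1) ^ i * (of_int (n + 1) gchoose i)) *\<^sub>V
          (mode V \<psi> (n + 1 + (-1) - int i) (mode V \<phi> (-1 + int i) vac) -
           ((-1) powi (n + 1)) *\<^sub>V mode V \<phi> (n + 1 + (-1) - int i) (mode V \<psi> (-1 + int i) vac)) = 0"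
      by (simp only: mode_nonneg_vac) (simp add: mode_right_simps)
  qed (simp add: mode_minus_one_vac)
  moreover have "Sum_any (\<lambda>i::nat. (of_int (-1) gchoose i) *\<^sub>V
      mode V (mode V \<psi> (n + 1 + int i) \<phi>) (-1 + (-1) - int i) vac) \<in> c2_space"
    by (intro subspace_Sum_any[OF subspace_c2_space] subspace_scale[OF subspace_c2_space]
        mode_in_c2_space) simp
  ultimately show ?thesis
    by (simp only: jacobi)
qed

text \<open>Commuting \<open>\<psi>\<^sub>n\<close> past a generator's mode
  \<open>\<phi>\<^sub>-\<^sub>2\<close> produces outer modes of index \<open>n - 2 - i\<close>,
  which is at most -2 because \<open>n \<le> 0\<close>.\<close>

lemma mode_right_c2_space:
  assumes "n \<in> {-1, 0}" "x \<in> c2_space"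
  shows "mode V \<psi> n x \<in> c2_space"
proof (rule linear_preserves_c2_space[OF linear_mode_right _ assms(2)])
  fix \<phi> \<xi>
  have "Sum_any (\<lambda>i::nat. (of_int n gchoose i) *\<^sub>V
      mode V (mode V \<psi> (int i) \<phi>) (n + (-2) - int i) \<xi>) \<in> c2_space"
    using assms(1)
    by (intro subspace_Sum_any[OF subspace_c2_space] subspace_scale[OF subspace_c2_space]
        mode_in_c2_space) auto
  then have "mode V \<psi> n (mode V \<phi> (-2) \<xi>) - mode V \<phi> (-2) (mode V \<psi> n \<xi>) \<in> c2_space"
    by (simp only: commutator)
  from subspace_add[OF subspace_c2_space this mode_in_c2_space[of "-2" \<phi> "mode V \<psi> n \<xi>"]]
  show "mode V \<psi> n (mode V \<phi> (-2) \<xi>) \<in> c2_space"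
    by simp
qed

lemma mode_left_c2_space:
  assumes "n \<in> {-1, 0}" "x \<in> c2_space"
  shows "mode V x n \<phi> \<in> c2_space"
proof -
  have "(-1) powi (n + 1) *\<^sub>V mode V \<phi> n x \<in> c2_space"
    by (intro subspace_scale[OF subspace_c2_space] mode_right_c2_space assms)
  from subspace_add[OF subspace_c2_space skew_symmetry[of x n \<phi>] this] show ?thesis
    by simp
qed

section \<open>Algebraic laws modulo \<open>c2_space\<close>\<close>

lemma dot_commute: "mode V \<psi> (-1) \<phi> - mode V \<phi> (-1) \<psi> \<in> c2_space"
  using skew_symmetry[of \<psi> "-1" \<phi>] by simp

lemma bracket_antisym: "mode V \<psi> 0 \<phi> + mode V \<phi> 0 \<psi> \<in> c2_space"
  using skew_symmetry[of \<psi> 0 \<phi>] by simp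

text \<open>In the iterate formula at \<open>n = -1\<close> every outer mode has index at most -2,
  except in the first summand at \<open>i = 0\<close>, which is the other bracketing.\<close>

lemma dot_assoc:
  "mode V (mode V \<psi> (-1) \<phi>) (-1) \<xi> - mode V \<psi> (-1) (mode V \<phi> (-1) \<xi>) \<in> c2_space"
proof -
  define g where "g i = mode V \<psi> (- 1 - int i) (mode V \<phi> (-1 + int i) \<xi>) +
      mode V \<phi> (-1 - 1 - int i) (mode V \<psi> (int i) \<xi>)" for i
  define t where "t = mode V \<psi> (-1) (mode V \<phi> (-1) \<xi>)"
  \<comment> \<open>\<open>Sum_any\<close> is 0 on an infinite support, so removing the single term
    \<open>t\<close> from the sum requires finiteness, which regularity supplies.\<close>
  have fin: "finite {i. g i \<noteq> 0}"
  proof -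
    obtain M where M: "\<And>n. n \<ge> M \<Longrightarrow> mode V \<phi> n \<xi> = 0"
      using regularity by blast
    obtain N where N: "\<And>n. n \<ge> N \<Longrightarrow> mode V \<psi> n \<xi> = 0"
      using regularity by blast
    have "g i = 0" if "i \<ge> nat (max (M + 1) N)" for i
      using that M[of "-1 + int i"] N[of "int i"] by (simp add: g_def mode_right_simps)
    then have "{i. g i \<noteq> 0} \<subseteq> {..nat (max (M + 1) N)}"
      using nat_le_linear by blast
    then show ?thesis
      by (rule finite_subset) simp
  qed
  have "Sum_any g - t = Sum_any (\<lambda>i. g i - (if i = 0 then t else 0))"
  proof -
    let ?I = "insert 0 {i. g i \<noteq> 0}"
    have I: "finite ?I"
      using fin by simp
    have "Sum_any g = sum g ?I"
      by (rule Sum_any.expand_superset[OF I]) auto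
    moreover have "Sum_any (\<lambda>i. g i - (if i = 0 then t else 0)) = (\<Sum>i\<in>?I. g i - (if i = 0 then t else 0))"
      by (rule Sum_any.expand_superset[OF I]) auto
    moreover have "(\<Sum>i\<in>?I. g i - (if i = 0 then t else 0)) = sum g ?I - t"
      unfolding sum_subtractf using I by simp
    ultimately show ?thesis by simp
  qed
  also have "\<dots> \<in> c2_space"
  proof (rule subspace_Sum_any[OF subspace_c2_space])
    fix i
    have "mode V \<psi> (- 1 - int i) (mode V \<phi> (-1 + int i) \<xi>) - (if i = 0 then t else 0) \<in> c2_space"
      using subspace_0[OF subspace_c2_space] by (auto simp: t_def intro: mode_in_c2_space)
    from subspace_add[OF subspace_c2_space this mode_in_c2_space[of "-1 - 1 - int i" \<phi> "mode V \<psi> (int i) \<xi>"]]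
    show "g i - (if i = 0 then t else 0) \<in> c2_space"
      by (simp add: g_def add_diff_eq diff_add_eq)
  qed
  finally show ?thesis
    unfolding iterate g_def t_def .
qed

text \<open>A zero mode is a derivation of every product \<open>\<phi>\<^sub>n \<xi>\<close>,
  exactly and not only modulo \<open>c2_space\<close>: for \<open>m = 0\<close> only
  \<open>i = 0\<close> survives.\<close>

lemma commutator_zero_mode:
  "mode V \<psi> 0 (mode V \<phi> n \<xi>) - mode V \<phi> n (mode V \<psi> 0 \<xi>) = mode V (mode V \<psi> 0 \<phi>) n \<xi>"
  unfolding commutator by (subst Sum_any_single[of 0]) (auto simp: gbinomial_0_left)

lemma bracket_jacobi:
  "mode V (mode V \<psi> 0 \<phi>) 0 \<xi> + mode V (mode V \<phi> 0 \<xi>) 0 \<psi> + mode V (mode V \<xi> 0 \<psi>) 0 \<phi> \<in> c2_space"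
proof -
  \<comment> \<open>\<open>?c\<close> and \<open>?d\<close> are antisymmetry defects, and
    \<open>?e\<close> is \<open>\<phi>\<^sub>0\<close> applied to one. In
    \<open>?c + ?d - ?e\<close> the terms \<open>\<phi>\<^sub>0 (\<xi>\<^sub>0 \<psi>)\<close>
    cancel, and the commutator of \<open>\<psi>\<^sub>0\<close> and \<open>\<phi>\<^sub>0\<close> on
    \<open>\<xi>\<close> becomes \<open>(\<psi>\<^sub>0 \<phi>)\<^sub>0 \<xi>\<close>.\<close>
  let ?c = "mode V \<psi> 0 (mode V \<phi> 0 \<xi>) + mode V (mode V \<phi> 0 \<xi>) 0 \<psi>"
  let ?d = "mode V \<phi> 0 (mode V \<xi> 0 \<psi>) + mode V (mode V \<xi> 0 \<psi>) 0 \<phi>"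
  let ?e = "mode V \<phi> 0 (mode V \<psi> 0 \<xi> + mode V \<xi> 0 \<psi>)"
  have "?c + ?d - ?e \<in> c2_space"
    by (rule subspace_diff[OF subspace_c2_space subspace_add[OF subspace_c2_space
          bracket_antisym bracket_antisym] mode_right_c2_space[OF _ bracket_antisym]]) simp
  moreover have "?c + ?d - ?e = mode V (mode V \<psi> 0 \<phi>) 0 \<xi> + mode V (mode V \<phi> 0 \<xi>) 0 \<psi> +
      mode V (mode V \<xi> 0 \<psi>) 0 \<phi>"
    by (simp add: commutator_zero_mode[symmetric] mode_right_simps)
  ultimately show ?thesis by simp
qed

section \<open>The grading\<close>

lemma weight_eigenvector_homogeneous:
  assumes "mode V \<omega> 1 \<psi> = of_int k *\<^sub>V \<psi>"
  shows "\<psi> \<in> F k"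
proof -
  obtain x where x: "\<And>n. x n \<in> F n" "finite {n. x n \<noteq> 0}" "\<psi> = Sum_any x"
    using grading_direct_sum[of \<psi>] by blast
  \<comment> \<open>These are the homogeneous components of
    \<open>L\<^sub>0 \<psi> - k \<psi> = 0\<close>; uniqueness of the decomposition of 0 forces
    \<open>x n = 0\<close> for \<open>n \<noteq> k\<close>.\<close>
  define y where "y n = of_int (n - k) *\<^sub>V x n" for n
  define P where "P z \<longleftrightarrow> (\<forall>n. z n \<in> F n) \<and> finite {n. z n \<noteq> 0} \<and> 0 = Sum_any z" for z
  have y: "y n \<in> F n" for n
    unfolding y_def by (rule subspace_scale[OF grading_subspace x(1)])
  have y_supp: "{n. y n \<noteq> 0} \<subseteq> {n. x n \<noteq> 0}"
    by (auto simp: y_def)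
  have psi: "\<psi> = sum x {n. x n \<noteq> 0}"
    unfolding x(3) by (rule Sum_any.expand_set)
  have "Sum_any y = (\<Sum>n | x n \<noteq> 0. y n)"
    by (rule Sum_any.expand_superset[OF x(2) y_supp])
  also have "\<dots> = (\<Sum>n | x n \<noteq> 0. mode V \<omega> 1 (x n)) - of_int k *\<^sub>V \<psi>"
    unfolding psi by (simp add: y_def weight[OF x(1)] scale_left_diff_distrib sum_subtractf scale_sum_right)
  also have "(\<Sum>n | x n \<noteq> 0. mode V \<omega> 1 (x n)) = mode V \<omega> 1 \<psi>"
    unfolding psi by (rule module_hom.sum[OF Vector_Spaces.linear.axioms(3)[OF linear_mode_right], symmetric])
  finally have "0 = Sum_any y"
    using assms by simp
  moreover have "finite {n. y n \<noteq> 0}"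
    using x(2) y_supp by (rule rev_finite_subset)
  ultimately have "P y"
    using y by (simp add: P_def)
  moreover have "P (\<lambda>n. 0)"
    using subspace_0[OF grading_subspace] by (simp add: P_def)
  moreover have "\<exists>!z. P z"
    unfolding P_def by (rule grading_direct_sum)
  ultimately have "y = (\<lambda>n. 0)"
    by blast
  then have "x n = 0" if "n \<noteq> k" for n
    using that by (auto simp: y_def fun_eq_iff)
  then have "\<psi> = x k"
    unfolding x(3) by (rule Sum_any_single)
  then show ?thesis
    using x(1) by simp
qed

text \<open>\<open>L\<^sub>0\<close> is \<open>\<omega>\<^sub>1\<close>, and its commutator with
  \<open>\<psi>\<^sub>k\<close> has two terms: \<open>i = 0\<close> contributes
  \<open>-(k + 1)\<close> by translation and \<open>i = 1\<close> contributes the weight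
  \<open>m\<close>. The weight \<open>n\<close> comes from \<open>\<phi>\<close>.\<close>

lemma mode_homogeneous:
  assumes "\<psi> \<in> F m" "\<phi> \<in> F n"
  shows "mode V \<psi> k \<phi> \<in> F (m + n - k - 1)"
proof (rule weight_eigenvector_homogeneous)
  have "mode V \<omega> 1 (mode V \<psi> k \<phi>) - mode V \<psi> k (mode V \<omega> 1 \<phi>) =
      (\<Sum>i\<le>1. (of_int 1 gchoose i) *\<^sub>V mode V (mode V \<omega> (int i) \<psi>) (1 + k - int i) \<phi>)"
    unfolding commutator
  proof (rule Sum_any.expand_superset)
    have "(1 :: complex) gchoose i = 0" if "\<not> i \<le> 1" for i
      using that binomial_gbinomial[of 1 i, where ?'a = complex] by (simp add: binomial_eq_0)
    then show "{i. (of_int 1 gchoose i) *\<^sub>V mode V (mode V \<omega> (int i) \<psi>) (1 + k - int i) \<phi> \<noteq> 0} \<subseteq> {..1}"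
      by auto
  qed simp
  also have "\<dots> = of_int (m - k - 1) *\<^sub>V mode V \<psi> k \<phi>"
    by (simp add: mode_translate weight[OF assms(1)] mode_left_simps algebra_simps)
  finally show "mode V \<omega> 1 (mode V \<psi> k \<phi>) = of_int (m + n - k - 1) *\<^sub>V mode V \<psi> k \<phi>"
    by (simp add: weight[OF assms(2)] mode_right_simps algebra_simps)
qed

end

section \<open>Descent to the quotient\<close>

theorem theorem4:
  fixes scale :: "complex \<Rightarrow> 'a::ab_group_add \<Rightarrow> 'a"
    and F :: "int \<Rightarrow> 'a set"
    and V :: "'a \<Rightarrow> int \<Rightarrow> 'a \<Rightarrow> 'a"
    and vac \<omega> :: 'a
    and C :: "'a set"
    and dot br :: "'a set \<Rightarrow> 'a set \<Rightarrow> 'a set"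
  assumes "vertex_algebra scale F V vac \<omega>"
    and C: "C = module.span scale {mode V \<psi> (-2) \<phi> | \<psi> \<phi>. True}"
    and dot: "dot = quot_op C (\<lambda>\<psi> \<phi>. mode V \<psi> (-1) \<phi>)"
    and br: "br = quot_op C (\<lambda>\<psi> \<phi>. mode V \<psi> 0 \<phi>)"
  shows "(\<forall>\<psi> \<phi>. dot (\<psi> +o C) (\<phi> +o C) = mode V \<psi> (-1) \<phi> +o C) \<and>
    (\<forall>\<psi> \<phi>. br (\<psi> +o C) (\<phi> +o C) = mode V \<psi> 0 \<phi> +o C) \<and>
    quot_bilinear scale C dot \<and>
    quot_bilinear scale C br \<and>
    (\<forall>\<psi>\<in>quot_space UNIV C. \<forall>\<phi>\<in>quot_space UNIV C. \<forall>\<xi>\<in>quot_space UNIV C.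
      dot \<psi> \<phi> = dot \<phi> \<psi> \<and>
      dot (dot \<psi> \<phi>) \<xi> = dot \<psi> (dot \<phi> \<xi>) \<and>
      br \<psi> \<phi> = uminus ` br \<phi> \<psi> \<and>
      br (br \<psi> \<phi>) \<xi> + br (br \<phi> \<xi>) \<psi> + br (br \<xi> \<psi>) \<phi> = C \<and>
      br \<psi> (dot \<phi> \<xi>) = dot (br \<psi> \<phi>) \<xi> + dot \<phi> (br \<psi> \<xi>)) \<and>
    (\<forall>m n. \<forall>A\<in>quot_space (F m) (C \<inter> F m). \<forall>B\<in>quot_space (F n) (C \<inter> F n).
      br (quot_incl C A) (quot_incl C B)
        \<in> quot_incl C ` quot_space (F (m + n - 1)) (C \<inter> F (m + n - 1)))"
proof -
  interpret vertex_algebra scale F V vac \<omega> by (rule assms(1))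
  have C_eq: "C = c2_space"
    unfolding C c2_space_def ..
  note subC = subspace_c2_space
  note coset_eq = coset_eq_iff[OF subC]
  have dot_coset: "dot (\<psi> +o C) (\<phi> +o C) = mode V \<psi> (-1) \<phi> +o C" for \<psi> \<phi>
    unfolding dot C_eq
    by (rule quot_op_coset[OF vector_space_axioms subC linear_mode_left linear_mode_right])
      (auto intro: mode_left_c2_space mode_right_c2_space)
  have br_coset: "br (\<psi> +o C) (\<phi> +o C) = mode V \<psi> 0 \<phi> +o C" for \<psi> \<phi>
    unfolding br C_eq
    by (rule quot_op_coset[OF vector_space_axioms subC linear_mode_left linear_mode_right])
      (auto intro: mode_left_c2_space mode_right_c2_space)
  have dot_bilinear: "quot_bilinear scale C dot"
    unfolding dot C_eq
    by (rule quot_bilinear_quot_op[OF vector_space_axioms subC linear_mode_left linear_mode_right])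
      (auto intro: mode_left_c2_space mode_right_c2_space)
  have br_bilinear: "quot_bilinear scale C br"
    unfolding br C_eq
    by (rule quot_bilinear_quot_op[OF vector_space_axioms subC linear_mode_left linear_mode_right])
      (auto intro: mode_left_c2_space mode_right_c2_space)
  have laws: "dot A B = dot B A \<and>
      dot (dot A B) D = dot A (dot B D) \<and>
      br A B = uminus ` br B A \<and>
      br (br A B) D + br (br B D) A + br (br D A) B = C \<and>
      br A (dot B D) = dot (br A B) D + dot B (br A D)"
    if ABD: "A \<in> quot_space UNIV C" "B \<in> quot_space UNIV C" "D \<in> quot_space UNIV C" for A B D
  proof -
    obtain \<psi> \<phi> \<xi> where reps: "A = \<psi> +o C" "B = \<phi> +o C" "D = \<xi> +o C"
      using ABD by (auto simp: quot_space_def)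
    have zero: "x +o C = C" if "x \<in> C" for x
      using that coset_eq[of x 0] by (simp add: C_eq)
    \<comment> \<open>The Leibniz rule already holds for representatives, without passing to
      cosets.\<close>
    have leibniz: "mode V \<psi> 0 (mode V \<phi> (-1) \<xi>) =
        mode V (mode V \<psi> 0 \<phi>) (-1) \<xi> + mode V \<phi> (-1) (mode V \<psi> 0 \<xi>)"
      using commutator_zero_mode[of \<psi> \<phi> "-1" \<xi>] by (simp add: algebra_simps)
    show ?thesis
      unfolding reps dot_coset br_coset
      using dot_commute[of \<psi> \<phi>] dot_assoc[of \<psi> \<phi> \<xi>] bracket_antisym[of \<psi> \<phi>]
        zero[unfolded C_eq, OF bracket_jacobi[of \<psi> \<phi> \<xi>]]
      by (simp add: C_eq coset_eq coset_add[OF subC] coset_uminus[OF subC] leibniz)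
  qed
  have graded: "br (quot_incl C A) (quot_incl C B)
      \<in> quot_incl C ` quot_space (F (m + n - 1)) (C \<inter> F (m + n - 1))"
    if AB: "A \<in> quot_space (F m) (C \<inter> F m)" "B \<in> quot_space (F n) (C \<inter> F n)" for m n A B
  proof -
    \<comment> \<open>This turns graded cosets into full cosets of \<open>C\<close>, to which
      \<open>br_coset\<close> applies.\<close>
    have incl: "quot_incl C (u +o (C \<inter> F k)) = u +o C" for u k
      unfolding C_eq by (rule quot_incl_coset[OF module_axioms grading_subspace subC])
    obtain \<psi> \<phi> where reps: "A = \<psi> +o (C \<inter> F m)" "B = \<phi> +o (C \<inter> F n)" "\<psi> \<in> F m" "\<phi> \<in> F n"
      using AB by (auto simp: quot_space_def)
    have "mode V \<psi> 0 \<phi> \<in> F (m + n - 1)"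
      using mode_homogeneous[OF reps(3,4), of 0] by simp
    moreover have "br (quot_incl C A) (quot_incl C B) =
        quot_incl C (mode V \<psi> 0 \<phi> +o (C \<inter> F (m + n - 1)))"
      by (simp add: reps incl br_coset)
    ultimately show ?thesis
      unfolding quot_space_def by blast
  qed
  show ?thesis
    \<comment> \<open>The nested \<open>conjI\<close> splits only the six outer conjuncts, so the
      conjunction of the five laws stays whole and matches \<open>laws\<close>.\<close>
    by (intro conjI[OF _ conjI[OF _ conjI[OF _ conjI[OF _ conjI]]]] allI ballI
        dot_coset br_coset dot_bilinear br_bilinear laws graded)
qed

end
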